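(* Let $n$ be a positive integer and let $D_n$ be a maximal Diophantine graph of order $n$ with Diophantine labelling $f$. For each vertex $u$ of $D_n$, $\deg(u)=n-1$ if and only if exactly one of the following two conditions holds: (1) there is a prime number $p$ such that $f(u)=p^{\acute{v}_p(n)}$, and $\frac{n}{2}<f(u)<n$; (2) $f(u)\mid n$.
   Context: All graphs are finite, simple and undirected, and $(a,b)$ denotes the greatest common divisor of $a$ and $b$. A graph $G=(V,E)$ of order $n$ is a Diophantine graph if there is a bijection $f:V\to\{1,2,\dots,n\}$ (a Diophantine labelling) such that $(f(u),f(v))\mid n$ for all $uv\in E$. It is a maximal Diophantine graph, denoted $(D_n,f)$ or simply $D_n$, if adding any new edge turns it into a non-Diophantine graph; thus two distinct vertices $u,v$ of $D_n$ are adjacent if and only if $(f(u),f(v))\mid n$. For a prime $p$, $v_p(n)$ is the $p$-adic valuation of $n$, and $\acute{v}_p(n):=v_p(n)+1$. *)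

theory Defs
  imports Complex_Main "HOL-Computational_Algebra.Primes"
begin

locale simple_graph =
  fixes V :: "'a set" and E :: "'a set set"
  assumes finite_verts: "finite V"
    and edges: "E \<subseteq> {e. e \<subseteq> V \<and> card e = 2}"

definition vert_degree :: "'a set set \<Rightarrow> 'a \<Rightarrow> nat" where
  "vert_degree E u = card {e \<in> E. u \<in> e}"

definition diophantine_labelling :: "'a set \<Rightarrow> 'a set set \<Rightarrow> ('a \<Rightarrow> nat) \<Rightarrow> bool" where
  "diophantine_labelling V E f \<longleftrightarrow>
     bij_betw f V {1..card V} \<and>
     (\<forall>u v. {u, v} \<in> E \<longrightarrow> gcd (f u) (f v) dvd card V)"

definition diophantine_graph :: "'a set \<Rightarrow> 'a set set \<Rightarrow> bool" where
  "diophantine_graph V E \<longleftrightarrow> simple_graph V E \<and> (\<exists>f. diophantine_labelling V E f)"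

text \<open>After adding a new edge, no labelling at all is Diophantine, not merely the given one.\<close>

definition maximal_diophantine_graph :: "'a set \<Rightarrow> 'a set set \<Rightarrow> bool" where
  "maximal_diophantine_graph V E \<longleftrightarrow>
     diophantine_graph V E \<and>
     (\<forall>u\<in>V. \<forall>v\<in>V. u \<noteq> v \<and> {u, v} \<notin> E \<longrightarrow> \<not> diophantine_graph V (insert {u, v} E))"

end

theory Submission
  imports Defs
begin

text \<open>By maximality, \<open>u\<close> has full degree iff \<open>gcd (f u) m dvd n\<close> for every label \<open>m \<noteq> f u\<close>.
  If \<open>f u\<close> does not divide \<open>n\<close>, some prime power \<open>q = p ^ (multiplicity p n + 1)\<close> divides \<open>f u\<close>
  but not \<open>n\<close>; the labels \<open>q\<close> and \<open>2 * f u\<close> would both violate this condition, so \<open>f u = q\<close>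
  and \<open>2 * f u > n\<close>.\<close>

text \<open>Edges have exactly two elements, so \<open>v\<close> \<mapsto> \<open>{u, v}\<close> is
  a bijection from the neighbours of \<open>u\<close> onto the edges through
  \<open>u\<close>.\<close>

lemma (in simple_graph) vert_degree_eq_card_neighbours:
  "vert_degree E u = card {v \<in> V - {u}. {u, v} \<in> E}"
proof -
  have "\<exists>v \<in> V - {u}. e = {u, v}" if "e \<in> E" "u \<in> e" for e
  proof -
    have "card e = 2" "e \<subseteq> V" using edges that by auto
    then obtain x y where "e = {x, y}" "x \<noteq> y" by (auto simp: card_2_iff)
    with \<open>e \<subseteq> V\<close> \<open>u \<in> e\<close> show ?thesis by auto
  qed
  then have "{e \<in> E. u \<in> e} = (\<lambda>v. {u, v}) ` {v \<in> V - {u}. {u, v} \<in> E}"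
    by blast
  moreover have "inj_on (\<lambda>v. {u, v}) {v \<in> V - {u}. {u, v} \<in> E}"
    by (auto simp: inj_on_def doubleton_eq_iff)
  ultimately show ?thesis
    by (simp add: vert_degree_def card_image)
qed

text \<open>The neighbours of \<open>u\<close> form a subset of the finite set
  \<open>V - {u}\<close>, and a subset of full cardinality is the whole set.\<close>

lemma (in simple_graph) vert_degree_full_iff:
  assumes "u \<in> V"
  shows "vert_degree E u = card V - 1 \<longleftrightarrow> (\<forall>v \<in> V - {u}. {u, v} \<in> E)"
proof -
  have "card V - 1 = card (V - {u})" using assms by simp
  moreover have "card {v \<in> V - {u}. {u, v} \<in> E} = card (V - {u})
      \<longleftrightarrow> {v \<in> V - {u}. {u, v} \<in> E} = V - {u}"
    using finite_verts by (metis (no_types, lifting) card_subset_eq finite_Diff mem_Collect_eq subsetI)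
  ultimately show ?thesis
    unfolding vert_degree_eq_card_neighbours by auto
qed

text \<open>If \<open>f\<close> allows the edge \<open>{u, v}\<close>, then \<open>f\<close> itself
  still labels the graph enlarged by it; maximality rules out every labelling of a properly enlarged
  graph, so the edge is already present.\<close>

lemma maximal_diophantine_adjacent_iff:
  assumes max: "maximal_diophantine_graph V E" and lab: "diophantine_labelling V E f"
    and uv: "u \<in> V" "v \<in> V" "u \<noteq> v"
  shows "{u, v} \<in> E \<longleftrightarrow> gcd (f u) (f v) dvd card V"
proof
  show "gcd (f u) (f v) dvd card V" if "{u, v} \<in> E"
    using lab that by (auto simp: diophantine_labelling_def)
  assume dvd: "gcd (f u) (f v) dvd card V"
  have "simple_graph V E"
    using max by (simp add: maximal_diophantine_graph_def diophantine_graph_def)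
  then have "simple_graph V (insert {u, v} E)"
    using uv by (auto simp: simple_graph_def)
  moreover have "diophantine_labelling V (insert {u, v} E) f"
    using lab dvd by (auto simp: diophantine_labelling_def doubleton_eq_iff gcd.commute)
  ultimately have "diophantine_graph V (insert {u, v} E)"
    by (auto simp: diophantine_graph_def)
  then show "{u, v} \<in> E"
    using max uv by (auto simp: maximal_diophantine_graph_def)
qed

lemma prime_power_Suc_multiplicity_not_dvd:
  fixes n p :: nat
  assumes "n > 0" "prime p"
  shows "\<not> p ^ (multiplicity p n + 1) dvd n"
  using assms multiplicity_geI[of n p "multiplicity p n + 1"] not_prime_unit[of p] by fastforce

lemma all_gcd_dvd_iff:
  fixes a n :: nat
  assumes n: "n > 0" and a: "a \<in> {1..n}"
  shows "(\<forall>m \<in> {1..n} - {a}. gcd a m dvd n) \<longleftrightarrow>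
    a dvd n \<or> (\<exists>p. prime p \<and> a = p ^ (multiplicity p n + 1)) \<and> n < 2 * a \<and> a < n"
    (is "?L \<longleftrightarrow> _ \<or> ?R")
proof (intro iffI)
  assume L: ?L
  have "?R" if ndvd: "\<not> a dvd n"
  proof -
    obtain p where p: "prime p" "multiplicity p n < multiplicity p a"
      using ndvd n a multiplicity_le_imp_dvd[of a n] by (metis atLeastAtMost_iff not_le not_one_le_zero)
    let ?q = "p ^ (multiplicity p n + 1)"
    have qa: "?q dvd a"
      using p by (intro multiplicity_dvd') simp
    then have "?q \<le> n" using a by (auto dest: dvd_imp_le)
    moreover have "?q \<ge> 1" using p by (simp add: prime_gt_0_nat Suc_leI del: power_Suc)
    \<comment> \<open>Since \<open>?q\<close> divides \<open>a\<close>, this gcd is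
      \<open>?q\<close> itself. The label \<open>?q\<close> thus violates the condition in
      \<open>?L\<close>, which exempts only \<open>a\<close>.\<close>
    moreover have "\<not> gcd a ?q dvd n"
      using qa prime_power_Suc_multiplicity_not_dvd[OF n p(1)] by (simp add: gcd_nat.absorb2)
    ultimately have "a = ?q" using L by (metis Diff_iff atLeastAtMost_iff singletonD)
    moreover have "n < 2 * a"
    proof (rule ccontr)
      assume "\<not> n < 2 * a"
      then have "2 * a \<in> {1..n} - {a}" using a by auto
      with L have "gcd a (2 * a) dvd n" by blast
      with ndvd show False by simp
    qed
    \<comment> \<open>The case \<open>a = n\<close> would contradict \<open>ndvd\<close>.\<close>
    moreover have "a < n" using a ndvd by (cases "a = n") auto
    ultimately show ?thesis using p(1) by blast
  qed
  then show "a dvd n \<or> ?R" by blast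
next
  assume "a dvd n \<or> ?R"
  then show ?L
  proof
    assume "a dvd n"
    then show ?L using gcd_dvd1 dvd_trans by blast
  next
    assume ?R
    then obtain p where p: "prime p" "a = p ^ (multiplicity p n + 1)" and big: "n < 2 * a"
      by blast
    show ?L
    proof
      fix m assume m: "m \<in> {1..n} - {a}"
      \<comment> \<open>The gcd is a power of \<open>p\<close>, and among the possible exponents
        only the largest one gives a non-divisor of \<open>n\<close>; it remains to exclude that
        one.\<close>
      have "gcd a m dvd p ^ (multiplicity p n + 1)" using p(2) by simp
      then obtain i where i: "i \<le> multiplicity p n + 1" "gcd a m = p ^ i"
        unfolding divides_primepow_nat[OF p(1)] by blast
      \<comment> \<open>Otherwise the gcd is \<open>a\<close>, so \<open>m\<close> is a positive
        multiple of \<open>a\<close> other than \<open>a\<close>, hence at least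
        \<open>2 * a\<close>, which exceeds \<open>n\<close>.\<close>
      have "i \<noteq> multiplicity p n + 1"
      proof
        assume "i = multiplicity p n + 1"
        then have "a dvd m" using i p by (metis gcd_dvd2)
        then obtain k where k: "m = a * k" ..
        with m have "k \<noteq> 0" "k \<noteq> 1" by auto
        then have "a * 2 \<le> a * k" by (intro mult_le_mono2) simp
        moreover have "a * k \<le> n" using k m by simp
        ultimately show False using big by linarith
      qed
      then show "gcd a m dvd n" using i by (auto intro: multiplicity_dvd')
    qed
  qed
qed

theorem theorem4p1:
  fixes V :: "'a set" and E :: "'a set set" and f :: "'a \<Rightarrow> nat" and n :: nat and u :: 'a
  assumes "n > 0"
    and "maximal_diophantine_graph V E"
    and "card V = n"
    and "diophantine_labelling V E f"
    and "u \<in> V"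
  shows "vert_degree E u = n - 1 \<longleftrightarrow>
    (((\<exists>p::nat. prime p \<and> f u = p ^ (multiplicity p n + 1)) \<and>
        real n / 2 < real (f u) \<and> f u < n)
     \<noteq> (f u dvd n))"
proof -
  interpret simple_graph V E
    using assms(2) by (simp add: maximal_diophantine_graph_def diophantine_graph_def)
  have bij: "bij_betw f V {1..n}"
    using assms(3,4) by (simp add: diophantine_labelling_def)
  then have labels: "f ` (V - {u}) = {1..n} - {f u}"
    using \<open>u \<in> V\<close> by (auto simp: bij_betw_def inj_on_def)
  have "vert_degree E u = n - 1 \<longleftrightarrow> (\<forall>v \<in> V - {u}. gcd (f u) (f v) dvd n)"
    using vert_degree_full_iff[OF \<open>u \<in> V\<close>] maximal_diophantine_adjacent_iff[OF assms(2,4,5)] assms(3)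
    by auto
  also have "\<dots> \<longleftrightarrow> (\<forall>m \<in> {1..n} - {f u}. gcd (f u) m dvd n)"
    unfolding labels[symmetric] by blast
  also have "\<dots> \<longleftrightarrow> f u dvd n \<or>
      (\<exists>p. prime p \<and> f u = p ^ (multiplicity p n + 1)) \<and> n < 2 * f u \<and> f u < n"
    using bij \<open>u \<in> V\<close> by (intro all_gcd_dvd_iff[OF \<open>n > 0\<close>]) (auto simp: bij_betw_def)
  also have "n < 2 * f u \<longleftrightarrow> real n / 2 < real (f u)"
    by linarith
  \<comment> \<open>The two alternatives exclude each other, because
    \<open>p ^ (multiplicity p n + 1)\<close> never divides \<open>n\<close>; this turns the
    disjunction into the exclusive one.\<close>
  finally show ?thesis
    using prime_power_Suc_multiplicity_not_dvd[OF \<open>n > 0\<close>] by metis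
qed

end
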